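(* If $\varphi:\mathcal A\to M_n(\mathbb C)$ is a linear isometry (i.e. $\varphi$ is linear and $\|\varphi(A)\|=\|A\|$ for all $A\in\mathcal A$), then $\varphi$ preserves singular values: for every $A\in\mathcal A$, the matrices $A$ and $\varphi(A)$ have the same singular values (counted with multiplicity), equivalently $\det(\lambda I-A^*A)=\det(\lambda I-\varphi(A)^*\varphi(A))$ as polynomials in $\lambda$.
   Context: $S$ denotes the $n\times n$ nilpotent Jordan block with ones on the superdiagonal and zeros elsewhere. $\mathcal A=\{f(S): f\text{ a complex polynomial}\}$ is the algebra of $n\times n$ upper-triangular Toeplitz matrices. $\|\cdot\|$ is the operator norm on $M_n(\mathbb C)$ induced by the Euclidean norm on $\mathbb C^n$. *)

theory Defs
  imports "Jordan_Normal_Form.Schur_Decomposition" "Jordan_Normal_Form.Char_Poly"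
begin

definition jordan_S :: "nat \<Rightarrow> complex mat" where
  "jordan_S n = mat n n (\<lambda>(i,j). if j = i + 1 then 1 else 0)"

definition poly_mat :: "complex poly \<Rightarrow> complex mat \<Rightarrow> complex mat" where
  "poly_mat f M = mat (dim_row M) (dim_row M)
     (\<lambda>(i,j). \<Sum>k\<le>degree f. coeff f k * (M ^\<^sub>m k) $$ (i,j))"

text \<open>The algebra of n x n upper-triangular Toeplitz matrices: {f(S)}.\<close>
definition toeplitz_alg :: "nat \<Rightarrow> complex mat set" where
  "toeplitz_alg n = {poly_mat f (jordan_S n) | f. True}"

definition vnorm2 :: "complex vec \<Rightarrow> real" where
  "vnorm2 v = sqrt (\<Sum>i<dim_vec v. (cmod (v $ i))\<^sup>2)"

definition opnorm :: "complex mat \<Rightarrow> real" where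
  "opnorm M = Sup {vnorm2 (M *\<^sub>v x) | x. x \<in> carrier_vec (dim_col M) \<and> vnorm2 x \<le> 1}"

end

theory Submission
  imports Defs "Subresultants.Subresultant_Gcd" "HOL-Computational_Algebra.Field_as_Ring"
begin

text \<open>
Write \<open>p(X, Y)\<close> and \<open>q(X, Y)\<close> for the characteristic polynomials of \<open>Y\<^sup>* X\<close> and
\<open>\<phi>(Y)\<^sup>* \<phi>(X)\<close>. For \<open>X = Y\<close> they share the root \<open>\<parallel>X\<parallel>\<^sup>2\<close>. The resultant of \<open>p\<close> and \<open>q\<close> is a
polynomial in \<open>X\<close> and \<open>Y\<^sup>*\<close>; it vanishes on the diagonal \<open>X = Y\<close>, which is a totally real
subspace, hence identically, so \<open>p(X, Y)\<close> and \<open>q(X, Y)\<close> share a root for all \<open>X\<close> and \<open>Y\<close>.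

The matrix \<open>E = S\<^sup>n\<^sup>-\<^sup>1\<close> has only one nonzero column, so \<open>p(X + e E, Y) = P\<^sub>0 + e P\<^sub>1\<close> is affine in \<open>e\<close>.
If \<open>P\<^sub>0\<close> and \<open>P\<^sub>1\<close> are coprime, this bivariate polynomial is irreducible and is therefore equal to
\<open>q(X + e E, Y)\<close>. Coprimality holds at \<open>X = 1\<close>, \<open>Y = 1 + S\<close>, where \<open>P\<^sub>0 = (x - 1)\<^sup>n\<close> and
\<open>P\<^sub>1(1) \<noteq> 0\<close>, hence generically, and \<open>p = q\<close> everywhere by polynomial identity.
\<close>

subsection \<open>Polynomial families of matrices\<close>

definition common_root :: "complex poly \<Rightarrow> complex poly \<Rightarrow> bool" where
  "common_root p q \<longleftrightarrow> (\<exists>x. poly p x = 0 \<and> poly q x = 0)"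

text \<open>Common roots are the roots of the gcd, and over the complex numbers the gcd has a root
  exactly when it is not constant. The resultant turns this into one polynomial equation in the
  coefficients.\<close>

lemma common_root_iff_resultant:
  assumes "p \<noteq> 0"
  shows "common_root p q \<longleftrightarrow> resultant p q = 0"
proof -
  have g: "gcd p q \<noteq> 0" using assms by simp
  have "common_root p q \<longleftrightarrow> (\<exists>x. poly (gcd p q) x = 0)"
    unfolding common_root_def poly_eq_0_iff_dvd by (simp add: gcd_greatest_iff)
  also have "\<dots> \<longleftrightarrow> degree (gcd p q) \<noteq> 0"
  proof
    assume "\<exists>x. poly (gcd p q) x = 0"
    then obtain x where x: "poly (gcd p q) x = 0" ..
    show "degree (gcd p q) \<noteq> 0"
    proof
      assume "degree (gcd p q) = 0"
      then obtain a where "gcd p q = [:a:]" by (rule degree_eq_zeroE)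
      then show False using x g by simp
    qed
  next
    assume "degree (gcd p q) \<noteq> 0"
    then show "\<exists>x. poly (gcd p q) x = 0"
      by (intro fundamental_theorem_of_algebra) (simp add: constant_degree)
  qed
  finally show ?thesis by (simp add: resultant_0_gcd)
qed

lemma poly_eq_if_infinite_agree:
  fixes p q :: "complex poly"
  assumes "infinite {t. poly p t = poly q t}"
  shows "p = q"
proof (rule ccontr)
  assume "p \<noteq> q"
  then have "finite {t. poly (p - q) t = 0}" by (intro poly_roots_finite) simp
  then show False using assms by simp
qed

text \<open>Evaluation at \<open>t\<close> commutes with \<open>char_poly\<close>, and every
  coefficient of \<open>char_poly M\<close> is a polynomial in \<open>t\<close>, hence determined by
  infinitely many values.\<close>

lemma char_poly_eval_eq_of_infinite:
  fixes M N :: "complex poly mat"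
  assumes M: "M \<in> carrier_mat n n" and N: "N \<in> carrier_mat n n"
    and inf: "infinite {t. char_poly (map_mat (\<lambda>p. poly p t) M) = char_poly (map_mat (\<lambda>p. poly p t) N)}"
  shows "char_poly (map_mat (\<lambda>p. poly p t) M) = char_poly (map_mat (\<lambda>p. poly p t) N)"
proof -
  have "coeff (char_poly M) i = coeff (char_poly N) i" for i
  proof (rule poly_eq_if_infinite_agree)
    have "{t. char_poly (map_mat (\<lambda>p. poly p t) M) = char_poly (map_mat (\<lambda>p. poly p t) N)}
      \<subseteq> {t. poly (coeff (char_poly M) i) t = poly (coeff (char_poly N) i) t}"
      unfolding poly_hom.char_poly_hom[OF M] poly_hom.char_poly_hom[OF N]
      by (auto simp: poly_eq_iff coeff_map_poly)
    then show "infinite {t. poly (coeff (char_poly M) i) t = poly (coeff (char_poly N) i) t}"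
      using inf finite_subset by blast
  qed
  then have "char_poly M = char_poly N" by (simp add: poly_eq_iff)
  then show ?thesis
    unfolding poly_hom.char_poly_hom[OF M] poly_hom.char_poly_hom[OF N] by simp
qed

text \<open>The resultant of the two characteristic polynomials, taken over
  \<open>complex poly\<close>, is a polynomial in \<open>t\<close>. Infinitely many zeros make it
  vanish identically.\<close>

lemma common_root_eval_of_infinite:
  fixes M N :: "complex poly mat"
  assumes M: "M \<in> carrier_mat n n" and N: "N \<in> carrier_mat n n"
    and inf: "infinite {t. common_root (char_poly (map_mat (\<lambda>p. poly p t) M))
                             (char_poly (map_mat (\<lambda>p. poly p t) N))}"
  shows "common_root (char_poly (map_mat (\<lambda>p. poly p t) M)) (char_poly (map_mat (\<lambda>p. poly p t) N))"
proof -
  have "common_root (char_poly (map_mat (\<lambda>p. poly p t) M)) (char_poly (map_mat (\<lambda>p. poly p t) N))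
    \<longleftrightarrow> poly (resultant (char_poly M) (char_poly N)) t = 0" for t
  proof -
    \<comment> \<open>Resultants depend on the degrees, so evaluation commutes with them only when
      no degree drops; monic polynomials guarantee this.\<close>
    have deg: "degree (map_poly (\<lambda>p. poly p t) (char_poly K)) = degree (char_poly K)"
      if K: "K \<in> carrier_mat n n" for K
      using degree_monic_char_poly[OF K]
        degree_monic_char_poly[of "map_mat (\<lambda>p. poly p t) K" n] K
      by (simp add: poly_hom.char_poly_hom[OF K])
    have "char_poly (map_mat (\<lambda>p. poly p t) M) \<noteq> 0"
      using degree_monic_char_poly[of "map_mat (\<lambda>p. poly p t) M" n] M by auto
    then show ?thesis
      by (simp add: common_root_iff_resultant poly_hom.char_poly_hom[OF M] poly_hom.char_poly_hom[OF N]
          poly_hom.resultant_map_poly[OF deg[OF M] deg[OF N]])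
  qed
  note iff = this
  have "resultant (char_poly M) (char_poly N) = 0"
    using inf poly_roots_finite unfolding iff by blast
  then show ?thesis unfolding iff by simp
qed

text \<open>The matrix \<open>A + t B\<close>, with the parameter \<open>t\<close> as the variable
  of the polynomial entries.\<close>

definition pencil :: "complex mat \<Rightarrow> complex mat \<Rightarrow> complex poly mat" where
  "pencil A B = mat (dim_row A) (dim_col A) (\<lambda>(i,j). [:A $$ (i,j), B $$ (i,j):])"

lemma pencil_mult_carrier:
  assumes "A \<in> carrier_mat n n" "C \<in> carrier_mat n n"
  shows "pencil A B * pencil C D \<in> carrier_mat n n"
  using assms by (auto simp: pencil_def)

lemma eval_pencil_mult:
  assumes "A \<in> carrier_mat n n" "B \<in> carrier_mat n n" "C \<in> carrier_mat n n" "D \<in> carrier_mat n n"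
  shows "map_mat (\<lambda>p. poly p t) (pencil A B * pencil C D) = (A + t \<cdot>\<^sub>m B) * (C + t \<cdot>\<^sub>m D)"
proof -
  have ev: "map_mat (\<lambda>p. poly p t) (pencil A B) = A + t \<cdot>\<^sub>m B"
    if "A \<in> carrier_mat n n" "B \<in> carrier_mat n n" for A B :: "complex mat"
    using that by (intro eq_matI) (auto simp: pencil_def)
  have "map_mat (\<lambda>p. poly p t) (pencil A B * pencil C D)
    = map_mat (\<lambda>p. poly p t) (pencil A B) * map_mat (\<lambda>p. poly p t) (pencil C D)"
    by (rule semiring_hom.mat_hom_mult[OF poly_hom.semiring_hom_axioms, of _ n n _ n]) (use assms in \<open>auto simp: pencil_def\<close>)
  then show ?thesis using assms by (simp add: ev)
qed

lemma pencil_char_poly_eq_of_infinite: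
  fixes A B C D A' B' C' D' :: "complex mat"
  assumes carr: "A \<in> carrier_mat n n" "B \<in> carrier_mat n n" "C \<in> carrier_mat n n" "D \<in> carrier_mat n n"
      "A' \<in> carrier_mat n n" "B' \<in> carrier_mat n n" "C' \<in> carrier_mat n n" "D' \<in> carrier_mat n n"
    and inf: "infinite {t. char_poly ((A + t \<cdot>\<^sub>m B) * (C + t \<cdot>\<^sub>m D)) = char_poly ((A' + t \<cdot>\<^sub>m B') * (C' + t \<cdot>\<^sub>m D'))}"
  shows "char_poly ((A + t \<cdot>\<^sub>m B) * (C + t \<cdot>\<^sub>m D)) = char_poly ((A' + t \<cdot>\<^sub>m B') * (C' + t \<cdot>\<^sub>m D'))"
  using char_poly_eval_eq_of_infinite[of "pencil A B * pencil C D" n "pencil A' B' * pencil C' D'" t] carr inf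
  by (simp add: eval_pencil_mult pencil_mult_carrier)

lemma pencil_common_root_of_infinite:
  fixes A B C D A' B' C' D' :: "complex mat"
  assumes carr: "A \<in> carrier_mat n n" "B \<in> carrier_mat n n" "C \<in> carrier_mat n n" "D \<in> carrier_mat n n"
      "A' \<in> carrier_mat n n" "B' \<in> carrier_mat n n" "C' \<in> carrier_mat n n" "D' \<in> carrier_mat n n"
    and inf: "infinite {t. common_root (char_poly ((A + t \<cdot>\<^sub>m B) * (C + t \<cdot>\<^sub>m D)))
                             (char_poly ((A' + t \<cdot>\<^sub>m B') * (C' + t \<cdot>\<^sub>m D')))}"
  shows "common_root (char_poly ((A + t \<cdot>\<^sub>m B) * (C + t \<cdot>\<^sub>m D))) (char_poly ((A' + t \<cdot>\<^sub>m B') * (C' + t \<cdot>\<^sub>m D')))"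
  using common_root_eval_of_infinite[of "pencil A B * pencil C D" n "pencil A' B' * pencil C' D'" t] carr inf
  by (simp add: eval_pencil_mult pencil_mult_carrier)

subsection \<open>Affine families with a root in common\<close>

text \<open>\<open>f\<close> agrees, where \<open>v\<close> does not vanish, with a rational function whose denominator is a power of \<open>v\<close>.\<close>

definition clears_denominator :: "complex poly \<Rightarrow> (complex \<Rightarrow> complex) \<Rightarrow> bool" where
  "clears_denominator v f \<longleftrightarrow> (\<exists>R d. \<forall>x. poly v x \<noteq> 0 \<longrightarrow> poly R x = poly v x ^ d * f x)"

lemma clears_denominator_poly: "clears_denominator v (poly p)"
  unfolding clears_denominator_def by (rule exI[of _ p], rule exI[of _ 0]) simp

lemma clears_denominator_quotient: "clears_denominator v (\<lambda>x. poly u x / poly v x)"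
  unfolding clears_denominator_def by (rule exI[of _ u], rule exI[of _ 1]) simp

lemma clears_denominator_mult:
  assumes "clears_denominator v f" "clears_denominator v g"
  shows "clears_denominator v (\<lambda>x. f x * g x)"
proof -
  obtain R d S e where "\<forall>x. poly v x \<noteq> 0 \<longrightarrow> poly R x = poly v x ^ d * f x"
    "\<forall>x. poly v x \<noteq> 0 \<longrightarrow> poly S x = poly v x ^ e * g x"
    using assms unfolding clears_denominator_def by blast
  then have "\<forall>x. poly v x \<noteq> 0 \<longrightarrow> poly (R * S) x = poly v x ^ (d + e) * (f x * g x)"
    by (simp add: power_add)
  then show ?thesis unfolding clears_denominator_def by blast
qed

lemma clears_denominator_add:
  assumes "clears_denominator v f" "clears_denominator v g"
  shows "clears_denominator v (\<lambda>x. f x + g x)"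
proof -
  obtain R d S e where "\<forall>x. poly v x \<noteq> 0 \<longrightarrow> poly R x = poly v x ^ d * f x"
    "\<forall>x. poly v x \<noteq> 0 \<longrightarrow> poly S x = poly v x ^ e * g x"
    using assms unfolding clears_denominator_def by blast
  then have "\<forall>x. poly v x \<noteq> 0 \<longrightarrow> poly (R * v ^ e + S * v ^ d) x = poly v x ^ (d + e) * (f x + g x)"
    by (simp add: power_add algebra_simps)
  then show ?thesis unfolding clears_denominator_def by blast
qed

lemma clears_denominator_poly_compose:
  assumes "clears_denominator v f"
  shows "clears_denominator v (\<lambda>x. poly p (f x))"
proof (induction p)
  case 0
  show ?case unfolding clears_denominator_def by (auto intro: exI[of _ 0])
next
  case (pCons a p)
  have "poly [:a:] = (\<lambda>x. a)" by auto
  then have "clears_denominator v (\<lambda>x. a)" using clears_denominator_poly[of v "[:a:]"] by simp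
  then show ?case
    using clears_denominator_add clears_denominator_mult assms pCons.IH by simp
qed

text \<open>The outer variable of \<open>Q\<close> is \<open>x\<close> and the inner one is a
  parameter \<open>e\<close>. Substituting \<open>e = f x\<close> keeps the dependence on
  \<open>x\<close> rational; the induction is Horner's scheme in the outer variable.\<close>

lemma clears_denominator_bivariate:
  fixes Q :: "complex poly poly"
  assumes "clears_denominator v f"
  shows "clears_denominator v (\<lambda>x. poly (map_poly (\<lambda>p. poly p (f x)) Q) x)"
proof (induction Q)
  case 0
  show ?case unfolding clears_denominator_def by (auto intro: exI[of _ 0])
next
  case (pCons a Q)
  have "poly [:0,1:] = (\<lambda>x::complex. x)" by auto
  then have "clears_denominator v (\<lambda>x. x)" using clears_denominator_poly[of v "[:0,1:]"] by simp
  then have "clears_denominator v (\<lambda>x. poly a (f x) + x * poly (map_poly (\<lambda>p. poly p (f x)) Q) x)"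
    by (intro clears_denominator_add clears_denominator_mult clears_denominator_poly_compose[OF assms] pCons.IH)
  then show ?case by (simp add: poly_hom.map_poly_pCons_hom)
qed

section \<open>Comparing the roots of two monic families\<close>

lemma card_roots_rsquarefree:
  fixes p :: "complex poly"
  assumes "rsquarefree p"
  shows "card {x. poly p x = 0} = degree p"
proof -
  have p: "p \<noteq> 0" using assms by (simp add: rsquarefree_def)
  have "degree p = degree (smult (lead_coeff p) (\<Prod>z|poly p z = 0. [:-z, 1:]))"
    by (simp only: complex_poly_decompose_rsquarefree[OF assms])
  also have "\<dots> = (\<Sum>z|poly p z = 0. degree [:-z, 1:])"
    using p by (subst degree_smult_eq, subst degree_prod_sum_eq) auto
  finally show ?thesis by simp
qed

lemma coprime_if_no_common_root:
  assumes "p \<noteq> 0" "\<not> common_root p q"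
  shows "coprime p q"
proof -
  have "degree (gcd p q) = 0"
    using assms resultant_0_gcd[of p q] by (simp add: common_root_iff_resultant)
  moreover have "gcd p q \<noteq> 0" using assms by simp
  ultimately have "is_unit (gcd p q)" by (simp add: is_unit_iff_degree)
  then show ?thesis by (simp only: is_unit_gcd)
qed

text \<open>A concrete form of the irreducibility of \<open>P0 + e P1\<close>. The curve of its
  roots is rational, and \<open>Q\<close> vanishes at infinitely many of its points, hence on all of
  it. Where \<open>P0 + e P1\<close> has \<open>n\<close> simple roots, two monic polynomials of
  degree \<open>n\<close> then coincide; this covers all but finitely many \<open>e\<close>, and
  comparing coefficients covers the rest.\<close>

lemma linear_pencil_of_polys_eq:
  fixes P0 P1 :: "complex poly" and Q :: "complex poly poly"
  assumes n: "n > 0" and P0: "degree P0 = n" "coeff P0 n = 1" and P1: "degree P1 < n"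
    and Q: "degree Q = n" "coeff Q n = 1"
    and no_common: "\<not> common_root P0 P1"
    and common: "\<And>e. common_root (P0 + smult e P1) (map_poly (\<lambda>p. poly p e) Q)"
  shows "map_poly (\<lambda>p. poly p e) Q = P0 + smult e P1"
proof -
  \<comment> \<open>\<open>e = u x\<close> solves \<open>P0 x + e * P1 x = 0\<close>: the curve of roots is parametrised by \<open>x\<close>.\<close>
  define u where "u x = poly (- P0) x / poly P1 x" for x
  define q where "q e = map_poly (\<lambda>p. poly p e) Q" for e
  define p where "p e = P0 + smult e P1" for e
  have P0_ne: "P0 \<noteq> 0" using P0 by auto
  have root: "poly P1 x \<noteq> 0 \<and> u x = e" if "poly (p e) x = 0" for e x
  proof -
    have eq: "poly P0 x + e * poly P1 x = 0" using that by (simp add: p_def)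
    then have "poly P1 x \<noteq> 0" using no_common unfolding common_root_def by force
    moreover have "- poly P0 x = e * poly P1 x" using eq by (simp add: add_eq_0_iff)
    ultimately show ?thesis by (simp add: u_def)
  qed
  obtain R d where R: "\<And>x. poly P1 x \<noteq> 0 \<Longrightarrow> poly R x = poly P1 x ^ d * poly (q (u x)) x"
    using clears_denominator_bivariate[OF clears_denominator_quotient[of P1 "- P0"], of Q]
    unfolding clears_denominator_def u_def q_def by blast
  define Z where "Z = {x. poly P1 x \<noteq> 0 \<and> poly (q (u x)) x = 0}"
  \<comment> \<open>A common root \<open>x\<close> of \<open>p e\<close> and \<open>q e\<close> lies
    in \<open>Z\<close> and satisfies \<open>u x = e\<close>. So \<open>u\<close> maps
    \<open>Z\<close> onto all complex numbers, which forces \<open>Z\<close> to be infinite.\<close>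
  have "e \<in> u ` Z" for e
    using common[of e] root unfolding common_root_def Z_def p_def[symmetric] q_def[symmetric] by blast
  then have "u ` Z = UNIV" by blast
  then have "infinite Z" using infinite_UNIV_char_0 finite_imageI by metis
  moreover have "Z \<subseteq> {x. poly R x = 0}" using R by (auto simp: Z_def)
  ultimately have "R = 0" using poly_roots_finite finite_subset by blast
  have roots_sub: "poly (q e) x = 0" if "poly (p e) x = 0" for e x
    using R[of x] root[OF that] \<open>R = 0\<close> by simp
  \<comment> \<open>A multiple root of \<open>p e\<close> is a zero of this Wronskian.\<close>
  define W where "W = pderiv P0 * P1 - P0 * pderiv P1"
  \<comment> \<open>Otherwise \<open>P0\<close> divides \<open>pderiv P0 * P1\<close>, hence by
    coprimality \<open>pderiv P0\<close>, which is impossible for positive degree.\<close>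
  have "W \<noteq> 0"
  proof
    assume "W = 0"
    then have "P0 dvd pderiv P0 * P1" unfolding W_def by (metis dvd_triv_left right_minus_eq)
    then have "P0 dvd pderiv P0"
      using coprime_if_no_common_root[OF P0_ne no_common] by (simp add: coprime_dvd_mult_left_iff)
    then show False using n P0 by (simp add: dvd_pderiv_iff)
  qed
  then have fin: "finite (u ` {x. poly W x = 0})" using poly_roots_finite by blast
  have eq_good: "q e = p e" if e: "e \<notin> u ` {x. poly W x = 0}" for e
  proof -
    have deg_p: "degree (p e) = n" unfolding p_def
      using P0 P1 le_less_trans[OF degree_smult_le P1] by (simp add: degree_add_eq_left)
    have "poly (pderiv (p e)) x \<noteq> 0" if "poly (p e) x = 0" for x
    proof
      assume d: "poly (pderiv (p e)) x = 0"
      have "poly P0 x = - e * poly P1 x" using that by (simp add: p_def add_eq_0_iff2)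
      moreover have "poly (pderiv P0) x = - e * poly (pderiv P1) x"
        using d by (simp add: p_def pderiv_add pderiv_smult add_eq_0_iff2)
      ultimately have "poly W x = 0" by (simp add: W_def)
      then show False using root[OF that] e by blast
    qed
    then have "rsquarefree (p e)" by (auto simp: rsquarefree_roots)
    then have card: "card {x. poly (p e) x = 0} = n" using card_roots_rsquarefree deg_p by simp
    show ?thesis
    proof (rule poly_eqI_degree_lead_coeff[where n = n and A = "{x. poly (p e) x = 0}"])
      show "coeff (q e) n = coeff (p e) n"
        using Q P0 P1 by (simp add: q_def p_def coeff_map_poly coeff_eq_0)
      show "degree (q e) \<le> n" unfolding q_def using Q degree_map_poly_le by metis
    qed (use card deg_p roots_sub in auto)
  qed
  have inf: "infinite (- u ` {x. poly W x = 0})"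
    using fin by (simp add: finite_compl infinite_UNIV_char_0)
  have "coeff Q i = [:coeff P0 i, coeff P1 i:]" for i
  proof (rule poly_eq_if_infinite_agree)
    have "- u ` {x. poly W x = 0} \<subseteq> {e. poly (coeff Q i) e = poly [:coeff P0 i, coeff P1 i:] e}"
    proof
      fix e assume "e \<in> - u ` {x. poly W x = 0}"
      then have "coeff (q e) i = coeff (p e) i" using eq_good by simp
      then show "e \<in> {e. poly (coeff Q i) e = poly [:coeff P0 i, coeff P1 i:] e}"
        by (simp add: q_def p_def coeff_map_poly)
    qed
    then show "infinite {e. poly (coeff Q i) e = poly [:coeff P0 i, coeff P1 i:] e}"
      using inf finite_subset by blast
  qed
  then show ?thesis by (simp add: poly_eq_iff[of "map_poly _ _"] coeff_map_poly)
qed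

subsection \<open>The operator norm as a singular value\<close>

lemma index_mat_adjoint [simp]:
  fixes A :: "complex mat"
  shows "dim_row (mat_adjoint A) = dim_col A" "dim_col (mat_adjoint A) = dim_row A"
    "i < dim_col A \<Longrightarrow> j < dim_row A \<Longrightarrow> mat_adjoint A $$ (i,j) = cnj (A $$ (j,i))"
  by (auto simp: mat_adjoint_def mat_of_rows_def)

lemma mat_adjoint_carrier [simp]:
  "(A :: complex mat) \<in> carrier_mat n m \<Longrightarrow> mat_adjoint A \<in> carrier_mat m n"
  by auto

lemma mat_adjoint_add_smult:
  fixes A B :: "complex mat"
  assumes "A \<in> carrier_mat n m" "B \<in> carrier_mat n m"
  shows "mat_adjoint (A + c \<cdot>\<^sub>m B) = mat_adjoint A + cnj c \<cdot>\<^sub>m mat_adjoint B"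
  using assms by (intro eq_matI) auto

lemma cscalar_prod_mult_mat_vec:
  fixes A :: "complex mat"
  assumes "A \<in> carrier_mat n m" "v \<in> carrier_vec m" "w \<in> carrier_vec n"
  shows "(A *\<^sub>v v) \<bullet>c w = v \<bullet>c (mat_adjoint A *\<^sub>v w)"
proof -
  have "(A *\<^sub>v v) \<bullet>c w = (\<Sum>i<n. \<Sum>j<m. A $$ (i,j) * v $ j * cnj (w $ i))"
    using assms by (simp add: scalar_prod_def sum_distrib_right lessThan_atLeast0 mult_mat_vec_def row_def)
  also have "\<dots> = (\<Sum>j<m. \<Sum>i<n. A $$ (i,j) * v $ j * cnj (w $ i))"
    by (rule sum.swap)
  also have "\<dots> = v \<bullet>c (mat_adjoint A *\<^sub>v w)"
    using assms by (simp add: scalar_prod_def sum_distrib_left lessThan_atLeast0 mult_mat_vec_def row_def mult_ac)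
  finally show ?thesis .
qed

section \<open>The Euclidean norm and elementary bounds for \<open>opnorm\<close>\<close>

lemma vnorm2_nonneg: "vnorm2 v \<ge> 0"
  by (simp add: vnorm2_def sum_nonneg)

lemma vnorm2_power2: "(vnorm2 v)\<^sup>2 = (\<Sum>i<dim_vec v. (cmod (v $ i))\<^sup>2)"
  by (simp add: vnorm2_def sum_nonneg)

lemma vnorm2_power2_eq_cscalar_prod: "complex_of_real ((vnorm2 v)\<^sup>2) = v \<bullet>c v"
  unfolding vnorm2_power2
  by (simp add: scalar_prod_def lessThan_atLeast0 complex_norm_square del: of_real_power)

lemma vnorm2_smult: "vnorm2 (c \<cdot>\<^sub>v v) = cmod c * vnorm2 v"
  by (simp add: vnorm2_def norm_mult power_mult_distrib real_sqrt_mult flip: sum_distrib_left)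

lemma vnorm2_diff_smult:
  fixes v w :: "complex vec" and t :: real
  assumes "v \<in> carrier_vec n" "w \<in> carrier_vec n"
  shows "(vnorm2 (v - of_real t \<cdot>\<^sub>v w))\<^sup>2 = (vnorm2 v)\<^sup>2 - 2 * t * Re (v \<bullet>c w) + t\<^sup>2 * (vnorm2 w)\<^sup>2"
proof -
  have "(cmod (a - of_real t * b))\<^sup>2 = (cmod a)\<^sup>2 - 2 * t * Re (a * cnj b) + t\<^sup>2 * (cmod b)\<^sup>2" for a b
    by (simp only: cmod_power2) (simp add: power2_eq_square algebra_simps)
  then show ?thesis
    using assms by (simp add: vnorm2_power2 scalar_prod_def lessThan_atLeast0 sum.distrib
        sum_subtractf distrib_left flip: sum_distrib_left)
qed

lemma norm_le_vnorm2: "i < dim_vec v \<Longrightarrow> cmod (v $ i) \<le> vnorm2 v"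
  unfolding vnorm2_def by (rule real_le_rsqrt) (auto intro!: member_le_sum)

text \<open>Makes the \<open>Sup\<close> in \<open>opnorm\<close> a genuine least upper bound.
  Entries of vectors in the unit ball have modulus at most 1, so absolute row sums give a crude
  bound.\<close>

lemma bounded_vnorm2_image:
  "\<exists>c. \<forall>v. v \<in> carrier_vec (dim_col A) \<longrightarrow> vnorm2 v \<le> 1 \<longrightarrow> vnorm2 (A *\<^sub>v v) \<le> c"
proof (intro exI allI impI)
  fix v :: "complex vec" assume v: "v \<in> carrier_vec (dim_col A)" "vnorm2 v \<le> 1"
  have "cmod ((A *\<^sub>v v) $ i) \<le> (\<Sum>j<dim_col A. cmod (A $$ (i,j)))" if i: "i < dim_row A" for i
  proof -
    have "cmod ((A *\<^sub>v v) $ i) \<le> (\<Sum>j<dim_col A. cmod (A $$ (i,j) * v $ j))"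
      using v i by (simp add: scalar_prod_def lessThan_atLeast0 norm_sum)
    also have "\<dots> \<le> (\<Sum>j<dim_col A. cmod (A $$ (i,j)))"
    proof (rule sum_mono)
      fix j assume "j \<in> {..<dim_col A}"
      then have "cmod (v $ j) \<le> 1" using norm_le_vnorm2[of j v] v by auto
      then show "cmod (A $$ (i,j) * v $ j) \<le> cmod (A $$ (i,j))"
        by (simp add: norm_mult mult_left_le)
    qed
    finally show ?thesis .
  qed
  then show "vnorm2 (A *\<^sub>v v) \<le> sqrt (\<Sum>i<dim_row A. (\<Sum>j<dim_col A. cmod (A $$ (i,j)))\<^sup>2)"
    unfolding vnorm2_def by (intro real_sqrt_le_mono) (auto intro!: sum_mono power_mono)
qed

lemma vnorm2_mult_le_opnorm:
  assumes v: "v \<in> carrier_vec (dim_col A)"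
  shows "vnorm2 (A *\<^sub>v v) \<le> opnorm A * vnorm2 v"
proof -
  have bdd: "bdd_above {vnorm2 (A *\<^sub>v x) | x. x \<in> carrier_vec (dim_col A) \<and> vnorm2 x \<le> 1}"
    using bounded_vnorm2_image[of A] unfolding bdd_above_def by blast
  show ?thesis
  proof (cases "vnorm2 v = 0")
    case True
    then have "v = 0\<^sub>v (dim_col A)"
      using v norm_le_vnorm2[of _ v] by (intro eq_vecI) auto
    then have "A *\<^sub>v v = 0\<^sub>v (dim_row A)" by auto
    then show ?thesis using True by (simp add: vnorm2_def)
  next
    case False
    define u where "u = of_real (inverse (vnorm2 v)) \<cdot>\<^sub>v v"
    have pos: "vnorm2 v > 0" using False vnorm2_nonneg[of v] by simp
    have "vnorm2 u = 1" using pos by (simp add: u_def vnorm2_smult norm_inverse)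
    then have "vnorm2 (A *\<^sub>v u) \<le> opnorm A"
      unfolding opnorm_def using bdd v by (intro cSup_upper) (auto simp: u_def)
    moreover have "A *\<^sub>v u = of_real (inverse (vnorm2 v)) \<cdot>\<^sub>v (A *\<^sub>v v)"
      unfolding u_def using v by (intro mult_mat_vec) auto
    ultimately have "inverse (vnorm2 v) * vnorm2 (A *\<^sub>v v) \<le> opnorm A"
      using pos by (simp add: vnorm2_smult norm_inverse)
    then show ?thesis using pos by (simp add: field_simps)
  qed
qed

lemma opnorm_nonneg: "opnorm A \<ge> 0"
proof -
  have "vnorm2 (A *\<^sub>v 0\<^sub>v (dim_col A)) \<le> opnorm A"
    unfolding opnorm_def
  proof (rule cSup_upper)
    show "bdd_above {vnorm2 (A *\<^sub>v x) | x. x \<in> carrier_vec (dim_col A) \<and> vnorm2 x \<le> 1}"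
      using bounded_vnorm2_image[of A] unfolding bdd_above_def by blast
  qed (auto simp: vnorm2_def intro!: exI[of _ "0\<^sub>v (dim_col A)"])
  then show ?thesis using vnorm2_nonneg order_trans by blast
qed

lemma opnorm_le:
  assumes "c \<ge> 0" "\<And>v. v \<in> carrier_vec (dim_col A) \<Longrightarrow> vnorm2 (A *\<^sub>v v) \<le> c * vnorm2 v"
  shows "opnorm A \<le> c"
  unfolding opnorm_def
proof (rule cSup_least)
  show "{vnorm2 (A *\<^sub>v x) | x. x \<in> carrier_vec (dim_col A) \<and> vnorm2 x \<le> 1} \<noteq> {}"
    by (auto simp: vnorm2_def intro!: exI[of _ "0\<^sub>v (dim_col A)"])
next
  fix y assume "y \<in> {vnorm2 (A *\<^sub>v x) | x. x \<in> carrier_vec (dim_col A) \<and> vnorm2 x \<le> 1}"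
  then obtain x where x: "y = vnorm2 (A *\<^sub>v x)" "x \<in> carrier_vec (dim_col A)" "vnorm2 x \<le> 1" by blast
  show "y \<le> c" using assms(2)[OF x(2)] mult_left_le[OF x(3) assms(1)] x(1) by linarith
qed

text \<open>Argues without a maximising vector: if the square of the norm were not an eigenvalue of
  \<open>mat_adjoint A * A\<close>, a bounded inverse would push the supremum strictly below
  itself.\<close>

lemma opnorm_power2_root_char_poly:
  fixes A :: "complex mat"
  assumes A: "A \<in> carrier_mat n n" and n: "n > 0"
  shows "poly (char_poly (mat_adjoint A * A)) (of_real ((opnorm A)\<^sup>2)) = 0"
proof (rule ccontr)
  define m where "m = (opnorm A)\<^sup>2"
  define M where "M = mat_adjoint A * A"
  have M: "M \<in> carrier_mat n n" unfolding M_def by (intro mult_carrier_mat[OF mat_adjoint_carrier[OF A] A])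
  assume "poly (char_poly (mat_adjoint A * A)) (of_real ((opnorm A)\<^sup>2)) \<noteq> 0"
  then have "det (char_matrix M (of_real m)) \<noteq> 0"
    using eigenvalue_root_char_poly[OF M] eigenvalue_det[OF M] by (simp add: M_def m_def)
  then obtain K where K: "K \<in> carrier_mat n n" "char_matrix M (of_real m) * K = 1\<^sub>m n"
    using det_non_zero_imp_unit[of "char_matrix M (of_real m)" n "()"] M
    by (auto simp: Units_def ring_mat_def)
  obtain c0 where c0: "\<And>v. v \<in> carrier_vec n \<Longrightarrow> vnorm2 (K *\<^sub>v v) \<le> c0 * vnorm2 v"
    using vnorm2_mult_le_opnorm[of _ K] K by auto
  define c where "c = max c0 0"
  have c: "vnorm2 (K *\<^sub>v v) \<le> c * vnorm2 v" if "v \<in> carrier_vec n" for v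
    using c0[OF that] vnorm2_nonneg[of v] mult_right_mono[of c0 c "vnorm2 v"] by (simp add: c_def)
  \<comment> \<open>Chosen so that \<open>t = 1 / C\<close> is positive and
    \<open>t * (m * c\<^sup>2) \<le> 1\<close>, which controls the quadratic error term
    below.\<close>
  define C where "C = m * c\<^sup>2 + 1"
  have m0: "m \<ge> 0" by (simp add: m_def)
  have C: "C \<ge> 1" using m0 by (simp add: C_def)
  \<comment> \<open>If \<open>A\<^sup>*A - m\<close> were invertible, the norm bound could be improved: apply it to \<open>v - w / C\<close>
    with \<open>(m - A\<^sup>*A) w = v\<close>.\<close>
  have gap: "(vnorm2 (A *\<^sub>v v))\<^sup>2 \<le> (m - 1 / C) * (vnorm2 v)\<^sup>2" if v: "v \<in> carrier_vec n" for v
  proof -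
    define z where "z = K *\<^sub>v v"
    define w where "w = - 1 \<cdot>\<^sub>v z"
    have z: "z \<in> carrier_vec n" using K v by (simp add: z_def)
    have w: "w \<in> carrier_vec n" using z by (simp add: w_def)
    have "char_matrix M (of_real m) *\<^sub>v z = v"
      using K v M assoc_mult_mat_vec[of "char_matrix M (of_real m)" n n K n v] by (simp add: z_def)
    moreover have "(- of_real m \<cdot>\<^sub>m 1\<^sub>m n) *\<^sub>v z = - of_real m \<cdot>\<^sub>v (1\<^sub>m n *\<^sub>v z)"
      using z by (intro eq_vecI) (simp_all add: scalar_prod_def sum_distrib_left mult.assoc del: one_mult_mat_vec)
    ultimately have "M *\<^sub>v z + - of_real m \<cdot>\<^sub>v z = v"
      using M z add_mult_distrib_mat_vec[of M n n "- of_real m \<cdot>\<^sub>m 1\<^sub>m n" z]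
      by (simp add: char_matrix_def)
    then have Mz: "M *\<^sub>v z = v + of_real m \<cdot>\<^sub>v z"
      using M z by (intro eq_vecI) auto
    have "M *\<^sub>v w = - 1 \<cdot>\<^sub>v (M *\<^sub>v z)"
      unfolding w_def using M z by (intro mult_mat_vec)
    then have Mw: "M *\<^sub>v w = of_real m \<cdot>\<^sub>v w - v"
      unfolding Mz w_def using z v by (intro eq_vecI) auto
    have "vnorm2 w = vnorm2 (K *\<^sub>v v)"
      by (simp add: w_def z_def vnorm2_smult)
    then have w_le: "(vnorm2 w)\<^sup>2 \<le> c\<^sup>2 * (vnorm2 v)\<^sup>2"
      using c[OF v] vnorm2_nonneg by (metis power_mono power_mult_distrib)
    have "(A *\<^sub>v v) \<bullet>c (A *\<^sub>v w) = v \<bullet>c (M *\<^sub>v w)"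
      using A v w cscalar_prod_mult_mat_vec[OF A v, of "A *\<^sub>v w"] by (simp add: M_def assoc_mult_mat_vec[of _ n n _ n])
    also have "\<dots> = of_real m * (v \<bullet>c w) - v \<bullet>c v"
      using v w by (simp add: Mw scalar_prod_def algebra_simps sum_distrib_left sum_subtractf)
    \<comment> \<open>The term \<open>m * Re (v \<bullet>c w)\<close> will cancel against the same
      term in the expansion of \<open>m\<close> times the squared norm of \<open>v - t w\<close>.
      This leaves a gain of \<open>2 * t * (vnorm2 v)\<^sup>2\<close>, half of which pays for the
      error term.\<close>
    finally have Re_eq: "Re ((A *\<^sub>v v) \<bullet>c (A *\<^sub>v w)) = m * Re (v \<bullet>c w) - (vnorm2 v)\<^sup>2"
      by (simp flip: vnorm2_power2_eq_cscalar_prod)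
    define t where "t = 1 / C"
    have "(vnorm2 (A *\<^sub>v v - of_real t \<cdot>\<^sub>v (A *\<^sub>v w)))\<^sup>2 \<le> m * (vnorm2 (v - of_real t \<cdot>\<^sub>v w))\<^sup>2"
    proof -
      have "A *\<^sub>v v - of_real t \<cdot>\<^sub>v (A *\<^sub>v w) = A *\<^sub>v (v - of_real t \<cdot>\<^sub>v w)"
        using A v w by (simp add: mult_minus_distrib_mat_vec mult_mat_vec)
      then show ?thesis
        using vnorm2_mult_le_opnorm[of "v - of_real t \<cdot>\<^sub>v w" A] A v w vnorm2_nonneg
        unfolding m_def power_mult_distrib[symmetric] by (intro power_mono) auto
    qed
    then have "(vnorm2 (A *\<^sub>v v))\<^sup>2 + t\<^sup>2 * (vnorm2 (A *\<^sub>v w))\<^sup>2 + 2 * t * (vnorm2 v)\<^sup>2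
        \<le> m * (vnorm2 v)\<^sup>2 + m * t\<^sup>2 * (vnorm2 w)\<^sup>2"
      using A v w by (simp add: vnorm2_diff_smult[of _ n] Re_eq) (simp add: algebra_simps)
    moreover have "m * t\<^sup>2 * (vnorm2 w)\<^sup>2 \<le> t * (vnorm2 v)\<^sup>2"
    proof -
      have "m * t\<^sup>2 * (vnorm2 w)\<^sup>2 \<le> m * t\<^sup>2 * (c\<^sup>2 * (vnorm2 v)\<^sup>2)"
        using w_le m0 by (intro mult_left_mono) auto
      also have "\<dots> = t * (t * (m * c\<^sup>2)) * (vnorm2 v)\<^sup>2" by (simp add: power2_eq_square)
      also have "\<dots> \<le> t * 1 * (vnorm2 v)\<^sup>2"
        using C by (intro mult_right_mono mult_left_mono) (auto simp: t_def C_def field_simps)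
      finally show ?thesis by simp
    qed
    moreover have "t\<^sup>2 * (vnorm2 (A *\<^sub>v w))\<^sup>2 \<ge> 0" by simp
    ultimately have "(vnorm2 (A *\<^sub>v v))\<^sup>2 + t * (vnorm2 v)\<^sup>2 \<le> m * (vnorm2 v)\<^sup>2" by linarith
    then show ?thesis by (simp add: t_def algebra_simps)
  qed
  \<comment> \<open>Testing \<open>gap\<close> on one nonzero vector shows that the improved bound
    has a real square root.\<close>
  have "vnorm2 (unit_vec n 0) > 0" using norm_le_vnorm2[of 0 "unit_vec n 0"] n by simp
  then have mC: "m - 1 / C \<ge> 0"
    using gap[of "unit_vec n 0"] zero_le_power2[of "vnorm2 (A *\<^sub>v unit_vec n 0)"]
    by (smt (verit) mult_neg_pos unit_vec_carrier zero_less_power)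
  have "opnorm A \<le> sqrt (m - 1 / C)"
  proof (rule opnorm_le)
    fix v :: "complex vec" assume "v \<in> carrier_vec (dim_col A)"
    then have "(vnorm2 (A *\<^sub>v v))\<^sup>2 \<le> (sqrt (m - 1 / C) * vnorm2 v)\<^sup>2"
      using gap[of v] A mC by (simp add: power_mult_distrib)
    then show "vnorm2 (A *\<^sub>v v) \<le> sqrt (m - 1 / C) * vnorm2 v"
      by (rule power2_le_imp_le) (intro mult_nonneg_nonneg real_sqrt_ge_zero mC vnorm2_nonneg)
  qed (use mC in simp)
  then have "m \<le> m - 1 / C"
    using mC opnorm_nonneg[of A] power_mono[of "opnorm A" "sqrt (m - 1 / C)" 2] by (simp add: m_def)
  then show False using C by simp
qed

text \<open>Expand the determinant along column \<open>k\<close>: the cofactors do not involve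
  \<open>e\<close> and the entries are affine in \<open>e\<close>. The values at 0 and 1 determine
  constant term and slope.\<close>

lemma char_poly_add_smult_single_column:
  fixes A N :: "complex mat"
  assumes A: "A \<in> carrier_mat n n" and N: "N \<in> carrier_mat n n" and k: "k < n"
    and col: "\<And>i j. i < n \<Longrightarrow> j < n \<Longrightarrow> j \<noteq> k \<Longrightarrow> N $$ (i,j) = 0"
  shows "char_poly (A + e \<cdot>\<^sub>m N) = char_poly A + smult e (char_poly (A + N) - char_poly A)"
proof -
  define cof where "cof i = cofactor (char_poly_matrix A) i k" for i
  have expand: "char_poly (A + e \<cdot>\<^sub>m N)
      = (\<Sum>i<n. char_poly_matrix A $$ (i,k) * cof i) - smult e (\<Sum>i<n. [:N $$ (i,k):] * cof i)" for e
  proof -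
    have c: "char_poly_matrix (A + e \<cdot>\<^sub>m N) \<in> carrier_mat n n" using A N by simp
    have del: "mat_delete (char_poly_matrix (A + e \<cdot>\<^sub>m N)) i k = mat_delete (char_poly_matrix A) i k"
      if "i < n" for i
      by (intro eq_matI)
        (use A N k that col in \<open>auto simp: char_poly_matrix_def mat_delete_def\<close>)
    have "char_poly_matrix (A + e \<cdot>\<^sub>m N) $$ (i,k) = char_poly_matrix A $$ (i,k) - smult e [:N $$ (i,k):]"
      if "i < n" for i
      using A N k that by (simp add: char_poly_matrix_def)
    then show ?thesis
      unfolding char_poly_def laplace_expansion_column[OF c k] cof_def cofactor_def
      using del by (simp add: left_diff_distrib sum_subtractf smult_sum2)
  qed
  have "A + 0 \<cdot>\<^sub>m N = A" "A + 1 \<cdot>\<^sub>m N = A + N" using A N by auto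
  then show ?thesis using expand[of 0] expand[of 1] expand[of e] by simp
qed

subsection \<open>Isometries of matrix spaces\<close>

text \<open>The space \<open>V\<close> is abstract; all families below are lines
  \<open>X + c Y\<close> in it. Toeplitz structure enters only through a single-column matrix
  \<open>E\<close> in \<open>V\<close> and a pair without common root.\<close>

locale matrix_isometry =
  fixes n :: nat and V :: "complex mat set" and \<phi> :: "complex mat \<Rightarrow> complex mat"
  assumes n_pos: "n > 0"
    and V_carrier: "X \<in> V \<Longrightarrow> X \<in> carrier_mat n n"
    and V_add_smult: "X \<in> V \<Longrightarrow> Y \<in> V \<Longrightarrow> X + c \<cdot>\<^sub>m Y \<in> V"
    and \<phi>_carrier: "X \<in> V \<Longrightarrow> \<phi> X \<in> carrier_mat n n"
    and \<phi>_add_smult: "X \<in> V \<Longrightarrow> Y \<in> V \<Longrightarrow> \<phi> (X + c \<cdot>\<^sub>m Y) = \<phi> X + c \<cdot>\<^sub>m \<phi> Y"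
    and opnorm_\<phi>: "X \<in> V \<Longrightarrow> opnorm (\<phi> X) = opnorm X"
begin

lemma common_root_diagonal:
  assumes "X \<in> V"
  shows "common_root (char_poly (mat_adjoint X * X)) (char_poly (mat_adjoint (\<phi> X) * \<phi> X))"
  using opnorm_power2_root_char_poly[OF V_carrier[OF assms] n_pos]
    opnorm_power2_root_char_poly[OF \<phi>_carrier[OF assms] n_pos] opnorm_\<phi>[OF assms]
  unfolding common_root_def by auto

text \<open>For real \<open>t\<close> the adjoint of \<open>C + t D\<close> is
  \<open>mat_adjoint C + t mat_adjoint D\<close>, which is polynomial in \<open>t\<close>. The
  diagonal case therefore extends from the real line to every complex \<open>t\<close>.\<close>

lemma common_root_bilinear:
  assumes X: "X \<in> V" and Y: "Y \<in> V"
  shows "common_root (char_poly (mat_adjoint Y * X)) (char_poly (mat_adjoint (\<phi> Y) * \<phi> X))"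
proof -
  \<comment> \<open>\<open>C = (X + Y) / 2\<close> and \<open>D = (X - Y) / (2 \<i>)\<close>: the diagonal pairs are \<open>C + t D\<close> for real \<open>t\<close>,
    and \<open>t = \<i>\<close> gives the pair \<open>(X, Y)\<close>.\<close>
  define D where "D = (Y + - 1 \<cdot>\<^sub>m X) + ((\<i> / 2) - 1) \<cdot>\<^sub>m (Y + - 1 \<cdot>\<^sub>m X)"
  define C where "C = X + (1 / 2) \<cdot>\<^sub>m (Y + - 1 \<cdot>\<^sub>m X)"
  \<comment> \<open>With \<open>Z = Y - X\<close>, the form \<open>Z + (\<i> / 2 - 1) Z\<close> of
    \<open>D\<close> is just \<open>(\<i> / 2) Z\<close>, written so that \<open>V_add_smult\<close>
    applies.\<close>
  have V: "C \<in> V" "D \<in> V" unfolding C_def D_def by (intro V_add_smult X Y)+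
  have carr: "C \<in> carrier_mat n n" "D \<in> carrier_mat n n" "\<phi> C \<in> carrier_mat n n" "\<phi> D \<in> carrier_mat n n"
    using V V_carrier \<phi>_carrier by auto
  have XY: "X = C + \<i> \<cdot>\<^sub>m D" "Y = C + (- \<i>) \<cdot>\<^sub>m D"
    unfolding C_def D_def using V_carrier[OF X] V_carrier[OF Y]
    by (intro eq_matI; auto simp: algebra_simps)+
  have "common_root (char_poly ((mat_adjoint C + t \<cdot>\<^sub>m mat_adjoint D) * (C + t \<cdot>\<^sub>m D)))
      (char_poly ((mat_adjoint (\<phi> C) + t \<cdot>\<^sub>m mat_adjoint (\<phi> D)) * (\<phi> C + t \<cdot>\<^sub>m \<phi> D)))" for t
  proof (rule pencil_common_root_of_infinite[where n = n])
    have "complex_of_real s \<in> {t. common_root (char_poly ((mat_adjoint C + t \<cdot>\<^sub>m mat_adjoint D) * (C + t \<cdot>\<^sub>m D)))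
      (char_poly ((mat_adjoint (\<phi> C) + t \<cdot>\<^sub>m mat_adjoint (\<phi> D)) * (\<phi> C + t \<cdot>\<^sub>m \<phi> D)))}" for s
      using common_root_diagonal[OF V_add_smult[OF V, of "of_real s"]]
      by (simp add: \<phi>_add_smult V mat_adjoint_add_smult[OF carr(1,2)] mat_adjoint_add_smult[OF carr(3,4)])
    then have "range complex_of_real \<subseteq> {t. common_root (char_poly ((mat_adjoint C + t \<cdot>\<^sub>m mat_adjoint D) * (C + t \<cdot>\<^sub>m D)))
      (char_poly ((mat_adjoint (\<phi> C) + t \<cdot>\<^sub>m mat_adjoint (\<phi> D)) * (\<phi> C + t \<cdot>\<^sub>m \<phi> D)))}" by blast
    moreover have "infinite (range complex_of_real)"
      using inj_of_real infinite_UNIV_char_0 finite_imageD by blast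
    ultimately show "infinite {t. common_root (char_poly ((mat_adjoint C + t \<cdot>\<^sub>m mat_adjoint D) * (C + t \<cdot>\<^sub>m D)))
      (char_poly ((mat_adjoint (\<phi> C) + t \<cdot>\<^sub>m mat_adjoint (\<phi> D)) * (\<phi> C + t \<cdot>\<^sub>m \<phi> D)))}"
      using finite_subset by blast
  qed (use carr in auto)
  from this[of \<i>] show ?thesis
    unfolding XY \<phi>_add_smult[OF V] mat_adjoint_add_smult[OF carr(1,2)] mat_adjoint_add_smult[OF carr(3,4)]
    by simp
qed

text \<open>Perturb \<open>X\<close> to \<open>X + e E\<close>. One side becomes affine in
  \<open>e\<close> because \<open>E\<close> has a single nonzero column; nothing similar is known of
  \<open>\<phi> E\<close>, so the other side enters only as a monic polynomial with coefficients
  polynomial in \<open>e\<close>. The claim is the case \<open>e = 0\<close>.\<close>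

lemma char_poly_eq_generic:
  assumes X: "X \<in> V" and Y: "Y \<in> V" and E: "E \<in> V" and k: "k < n"
    and col: "\<And>i j. i < n \<Longrightarrow> j < n \<Longrightarrow> j \<noteq> k \<Longrightarrow> E $$ (i,j) = 0"
    and no_common: "\<not> common_root (char_poly (mat_adjoint Y * X)) (char_poly (mat_adjoint Y * (X + E)))"
  shows "char_poly (mat_adjoint Y * X) = char_poly (mat_adjoint (\<phi> Y) * \<phi> X)"
proof -
  note carr = V_carrier[OF X] V_carrier[OF Y] V_carrier[OF E]
    \<phi>_carrier[OF X] \<phi>_carrier[OF Y] \<phi>_carrier[OF E]
  define A where "A = mat_adjoint Y * X"
  define N where "N = mat_adjoint Y * E"
  have A: "A \<in> carrier_mat n n" and N: "N \<in> carrier_mat n n"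
    unfolding A_def N_def using carr by (auto intro!: mult_carrier_mat[of _ n n])
  have N_col: "N $$ (i,j) = 0" if "i < n" "j < n" "j \<noteq> k" for i j
    using that carr col by (simp add: N_def scalar_prod_def)
  have split: "mat_adjoint Y * (X + e \<cdot>\<^sub>m E) = A + e \<cdot>\<^sub>m N" for e
    unfolding A_def N_def using carr
    by (simp add: mult_add_distrib_mat[of _ n n _ n] mult_smult_distrib[of _ n n _ n])
  define P0 where "P0 = char_poly A"
  define P1 where "P1 = char_poly (A + N) - char_poly A"
  have P0: "degree P0 = n" "coeff P0 n = 1"
    using degree_monic_char_poly[OF A] by (auto simp: P0_def)
  have AN: "degree (char_poly (A + N)) = n" "coeff (char_poly (A + N)) n = 1"
    using degree_monic_char_poly[of "A + N" n] A N by auto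
  have "degree P1 < n"
  proof -
    have "degree P1 \<le> n" unfolding P1_def using AN P0 by (intro degree_diff_le) (auto simp: P0_def)
    moreover have "coeff P1 n = 0" using AN P0 by (simp add: P1_def P0_def)
    ultimately show ?thesis
      using n_pos by (metis coeff_0_degree_minus_1 degree_0 eq_zero_or_degree_less leading_coeff_0_iff le_neq_implies_less)
  qed
  have affine: "char_poly (mat_adjoint Y * (X + e \<cdot>\<^sub>m E)) = P0 + smult e P1" for e
    unfolding split P0_def P1_def by (rule char_poly_add_smult_single_column[OF A N k N_col])
  \<comment> \<open>The zero matrix keeps the first factor constant in \<open>e\<close>.\<close>
  define M where "M = pencil (mat_adjoint (\<phi> Y)) (0\<^sub>m n n) * pencil (\<phi> X) (\<phi> E)"
  have M: "M \<in> carrier_mat n n" unfolding M_def using carr by (intro pencil_mult_carrier) auto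
  have eval: "map_poly (\<lambda>p. poly p e) (char_poly M) = char_poly (mat_adjoint (\<phi> Y) * (\<phi> X + e \<cdot>\<^sub>m \<phi> E))" for e
  proof -
    have "mat_adjoint (\<phi> Y) + e \<cdot>\<^sub>m 0\<^sub>m n n = mat_adjoint (\<phi> Y)"
      using carr by (intro eq_matI) auto
    then have "map_mat (\<lambda>p. poly p e) M = mat_adjoint (\<phi> Y) * (\<phi> X + e \<cdot>\<^sub>m \<phi> E)"
      unfolding M_def using carr by (subst eval_pencil_mult[of _ n]) auto
    then show ?thesis using poly_hom.char_poly_hom[OF M, of e] by simp
  qed
  have "map_poly (\<lambda>p. poly p 0) (char_poly M) = P0 + smult 0 P1"
  proof (rule linear_pencil_of_polys_eq)
    \<comment> \<open>\<open>P1\<close> is the difference of the two characteristic polynomials in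
      \<open>no_common\<close>, so a common root with \<open>P0\<close> would be a root of
      both.\<close>
    show "\<not> common_root P0 P1"
      using no_common split[of 1] carr unfolding common_root_def P0_def P1_def A_def N_def
      by (auto simp: mult_add_distrib_mat[of _ n n _ n])
    show "common_root (P0 + smult e P1) (map_poly (\<lambda>p. poly p e) (char_poly M))" for e
      using common_root_bilinear[OF V_add_smult[OF X E, of e] Y]
      unfolding affine eval \<phi>_add_smult[OF X E] .
  qed (use n_pos P0 \<open>degree P1 < n\<close> degree_monic_char_poly[OF M] in auto)
  moreover have "\<phi> X + 0 \<cdot>\<^sub>m \<phi> E = \<phi> X" using carr by (intro eq_matI) auto
  ultimately show ?thesis by (simp add: eval P0_def A_def)
qed

text \<open>Join the pair \<open>(A, A)\<close> at \<open>w = 0\<close> to \<open>(X0, Y0)\<close>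
  at \<open>w = 1\<close> by a line. The generic case applies at \<open>w = 1\<close>, hence at all
  but finitely many \<open>w\<close>, and polynomial identity carries the equality back to
  \<open>w = 0\<close>.\<close>

lemma char_poly_adjoint_mult_eq:
  assumes A: "A \<in> V" and X0: "X0 \<in> V" and Y0: "Y0 \<in> V" and E: "E \<in> V" and k: "k < n"
    and col: "\<And>i j. i < n \<Longrightarrow> j < n \<Longrightarrow> j \<noteq> k \<Longrightarrow> E $$ (i,j) = 0"
    and no_common: "\<not> common_root (char_poly (mat_adjoint Y0 * X0)) (char_poly (mat_adjoint Y0 * (X0 + E)))"
  shows "char_poly (mat_adjoint A * A) = char_poly (mat_adjoint (\<phi> A) * \<phi> A)"
proof -
  define D where "D = X0 + - 1 \<cdot>\<^sub>m A"
  define F where "F = Y0 + - 1 \<cdot>\<^sub>m A"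
  have V: "D \<in> V" "F \<in> V" unfolding D_def F_def by (intro V_add_smult A X0 Y0)+
  note VS = V A E
  have carr: "A \<in> carrier_mat n n" "D \<in> carrier_mat n n" "F \<in> carrier_mat n n" "E \<in> carrier_mat n n"
    "\<phi> A \<in> carrier_mat n n" "\<phi> D \<in> carrier_mat n n" "\<phi> F \<in> carrier_mat n n"
    using VS V_carrier \<phi>_carrier by auto
  have X0_eq: "X0 = A + 1 \<cdot>\<^sub>m D" and Y0_eq: "Y0 = A + 1 \<cdot>\<^sub>m F"
    unfolding D_def F_def using carr V_carrier[OF X0] V_carrier[OF Y0] by (intro eq_matI; auto)+
  define bad where "bad w \<longleftrightarrow> common_root (char_poly ((mat_adjoint A + w \<cdot>\<^sub>m mat_adjoint F) * (A + w \<cdot>\<^sub>m D)))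
       (char_poly ((mat_adjoint A + w \<cdot>\<^sub>m mat_adjoint F) * ((A + E) + w \<cdot>\<^sub>m D)))" for w
  have swap: "A + w \<cdot>\<^sub>m D + E = (A + E) + w \<cdot>\<^sub>m D" for w using carr by (intro eq_matI) auto
  \<comment> \<open>Moving the second matrix along \<open>cnj w\<close> makes its adjoint polynomial
    in \<open>w\<close>.\<close>
  have adj: "mat_adjoint (A + cnj w \<cdot>\<^sub>m F) = mat_adjoint A + w \<cdot>\<^sub>m mat_adjoint F" for w
    using mat_adjoint_add_smult[OF carr(1,3), of "cnj w"] by simp
  have adj\<phi>: "mat_adjoint (\<phi> A + cnj w \<cdot>\<^sub>m \<phi> F) = mat_adjoint (\<phi> A) + w \<cdot>\<^sub>m mat_adjoint (\<phi> F)" for w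
    using mat_adjoint_add_smult[OF carr(5,7), of "cnj w"] by simp
  have "\<not> bad 1"
    using no_common adj[of 1] unfolding bad_def swap[symmetric] X0_eq Y0_eq by simp
  then have fin: "finite {w. bad w}"
    using pencil_common_root_of_infinite[of "mat_adjoint A" n "mat_adjoint F" A D "mat_adjoint A" "mat_adjoint F" "A + E" D 1] carr
    unfolding bad_def by auto
  have good: "char_poly ((mat_adjoint A + w \<cdot>\<^sub>m mat_adjoint F) * (A + w \<cdot>\<^sub>m D))
      = char_poly ((mat_adjoint (\<phi> A) + w \<cdot>\<^sub>m mat_adjoint (\<phi> F)) * (\<phi> A + w \<cdot>\<^sub>m \<phi> D))" if "\<not> bad w" for w
    using char_poly_eq_generic[OF V_add_smult[OF A V(1), of w] V_add_smult[OF A V(2), of "cnj w"] E k col] that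
    unfolding bad_def adj swap \<phi>_add_smult[OF A V(1)] \<phi>_add_smult[OF A V(2)] adj\<phi> by blast
  have "infinite (- {w. bad w})" using fin by (simp add: finite_compl infinite_UNIV_char_0)
  moreover have "- {w. bad w} \<subseteq> {w. char_poly ((mat_adjoint A + w \<cdot>\<^sub>m mat_adjoint F) * (A + w \<cdot>\<^sub>m D))
      = char_poly ((mat_adjoint (\<phi> A) + w \<cdot>\<^sub>m mat_adjoint (\<phi> F)) * (\<phi> A + w \<cdot>\<^sub>m \<phi> D))}"
    using good by blast
  ultimately have "infinite {w. char_poly ((mat_adjoint A + w \<cdot>\<^sub>m mat_adjoint F) * (A + w \<cdot>\<^sub>m D))
      = char_poly ((mat_adjoint (\<phi> A) + w \<cdot>\<^sub>m mat_adjoint (\<phi> F)) * (\<phi> A + w \<cdot>\<^sub>m \<phi> D))}"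
    using finite_subset by blast
  then have "char_poly ((mat_adjoint A + 0 \<cdot>\<^sub>m mat_adjoint F) * (A + 0 \<cdot>\<^sub>m D))
      = char_poly ((mat_adjoint (\<phi> A) + 0 \<cdot>\<^sub>m mat_adjoint (\<phi> F)) * (\<phi> A + 0 \<cdot>\<^sub>m \<phi> D))"
    using carr by (intro pencil_char_poly_eq_of_infinite[where n = n]) auto
  moreover have "B + 0 \<cdot>\<^sub>m C = B" if "B \<in> carrier_mat n n" "C \<in> carrier_mat n n" for B C :: "complex mat"
    using that by (intro eq_matI) auto
  ultimately show ?thesis using carr by simp
qed

end

subsection \<open>Toeplitz matrices\<close>

definition toeplitz :: "nat \<Rightarrow> (nat \<Rightarrow> complex) \<Rightarrow> complex mat" where
  "toeplitz n a = mat n n (\<lambda>(i,j). if i \<le> j then a (j - i) else 0)"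

lemma dim_row_jordan_S: "dim_row (jordan_S n) = n"
  by (simp add: jordan_S_def)

lemma jordan_S_pow:
  assumes "i < n" "j < n"
  shows "(jordan_S n ^\<^sub>m k) $$ (i,j) = (if j = i + k then 1 else 0)"
  using assms
proof (induction k arbitrary: j)
  case 0
  then show ?case by (simp add: jordan_S_def)
next
  case (Suc k)
  have S: "jordan_S n \<in> carrier_mat n n" by (simp add: jordan_S_def)
  have "(jordan_S n ^\<^sub>m Suc k) $$ (i,j)
      = (\<Sum>l<n. (jordan_S n ^\<^sub>m k) $$ (i,l) * jordan_S n $$ (l,j))"
    using Suc.prems S pow_carrier_mat[OF S, of k] by (simp add: scalar_prod_def lessThan_atLeast0)
  also have "\<dots> = (\<Sum>l<n. if l = i + k then (if j = i + Suc k then 1 else 0) else 0)"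
    using Suc by (intro sum.cong) (auto simp: jordan_S_def)
  also have "\<dots> = (if j = i + Suc k then 1 else 0)"
    using Suc.prems by (simp add: sum.delta)
  finally show ?case .
qed

lemma poly_mat_jordan_S: "poly_mat f (jordan_S n) = toeplitz n (coeff f)"
proof (rule eq_matI)
  fix i j assume "i < dim_row (toeplitz n (coeff f))" "j < dim_col (toeplitz n (coeff f))"
  then have ij: "i < n" "j < n" by (auto simp: toeplitz_def)
  then have "poly_mat f (jordan_S n) $$ (i,j) = (\<Sum>k\<le>degree f. coeff f k * (if j = i + k then 1 else 0))"
    by (simp add: poly_mat_def jordan_S_pow dim_row_jordan_S)
  also have "\<dots> = (\<Sum>k\<le>degree f. if k = j - i then (if i \<le> j then coeff f k else 0) else 0)"
    by (intro sum.cong) auto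
  also have "\<dots> = toeplitz n (coeff f) $$ (i,j)"
    using ij by (simp add: sum.delta toeplitz_def coeff_eq_0)
  finally show "poly_mat f (jordan_S n) $$ (i,j) = toeplitz n (coeff f) $$ (i,j)" .
qed (auto simp: poly_mat_def toeplitz_def jordan_S_def)

lemma toeplitz_alg_iff: "X \<in> toeplitz_alg n \<longleftrightarrow> (\<exists>f. X = toeplitz n (coeff f))"
  by (auto simp: toeplitz_alg_def poly_mat_jordan_S)

lemma toeplitz_add_smult:
  "toeplitz n (coeff f) + c \<cdot>\<^sub>m toeplitz n (coeff g) = toeplitz n (coeff (f + smult c g))"
  by (intro eq_matI) (auto simp: toeplitz_def)

text \<open>These are the identity, \<open>1 + S\<close> and the corner matrix unit. The adjoint of
  \<open>Y\<close> is unipotent, so 1 is the only candidate for a common root; solving the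
  eigenvector equation for 1 row by row excludes it.\<close>

lemma toeplitz_base_point:
  fixes n :: nat
  assumes n: "n > 0"
  defines "X \<equiv> toeplitz n (coeff 1)" and "Y \<equiv> toeplitz n (coeff [:1,1:])"
    and "E \<equiv> toeplitz n (coeff (monom 1 (n - 1)))"
  shows "\<not> common_root (char_poly (mat_adjoint Y * X)) (char_poly (mat_adjoint Y * (X + E)))"
proof -
  have carr: "X \<in> carrier_mat n n" "Y \<in> carrier_mat n n" "E \<in> carrier_mat n n"
    by (auto simp: X_def Y_def E_def toeplitz_def)
  have X: "X = 1\<^sub>m n" by (intro eq_matI) (auto simp: X_def toeplitz_def)
  have E: "E $$ (i,j) = (if i = 0 \<and> j = n - 1 then 1 else 0)" if "i < n" "j < n" for i j
    using that by (auto simp: E_def toeplitz_def)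
  have Y: "mat_adjoint Y $$ (i,j) = (if i = j \<or> i = Suc j then 1 else 0)" if "i < n" "j < n" for i j
    using that carr by (auto simp: Y_def toeplitz_def coeff_pCons split: nat.splits)
  have YT: "transpose_mat (mat_adjoint Y) \<in> carrier_mat n n" using carr by auto
  have "upper_triangular (transpose_mat (mat_adjoint Y))"
    using Y carr by (auto intro!: upper_triangularI)
  from char_poly_upper_triangular[OF YT this]
  have "char_poly (mat_adjoint Y) = (\<Prod>a\<leftarrow>diag_mat (transpose_mat (mat_adjoint Y)). [:-a, 1:])"
    using carr by (simp only: char_poly_transpose_mat[of "mat_adjoint Y" n] mat_adjoint_carrier)
  moreover have "diag_mat (transpose_mat (mat_adjoint Y)) = replicate n 1"
    using Y carr by (intro nth_equalityI) (auto simp: diag_mat_def)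
  ultimately have root1: "poly (char_poly (mat_adjoint Y)) x = 0 \<Longrightarrow> x = 1" for x
    by (simp add: poly_prod_list prod_list_zero_iff)
  have "poly (char_poly (mat_adjoint Y * (X + E))) 1 \<noteq> 0"
  proof
    define M where "M = mat_adjoint Y * (X + E)"
    have M: "M \<in> carrier_mat n n" unfolding M_def using carr by (intro mult_carrier_mat[of _ n n]) auto
    assume "poly (char_poly (mat_adjoint Y * (X + E))) 1 = 0"
    then have "eigenvalue M 1" using eigenvalue_root_char_poly[OF M] by (simp add: M_def)
    then obtain v where v: "v \<in> carrier_vec n" "v \<noteq> 0\<^sub>v n" "M *\<^sub>v v = v"
      using M by (auto simp: eigenvalue_def eigenvector_def)
    define u where "u = (X + E) *\<^sub>v v"
    have u_dim: "dim_vec u = n" using carr by (simp add: u_def)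
    have u: "u $ i = v $ i + (if i = 0 then v $ (n - 1) else 0)" if "i < n" for i
    proof -
      have "u $ i = (\<Sum>j<n. (X + E) $$ (i,j) * v $ j)"
        unfolding u_def using that v(1) carr by (simp add: scalar_prod_def lessThan_atLeast0)
      also have "\<dots> = (\<Sum>j<n. (if j = i then v $ i else 0) + (if j = n - 1 then (if i = 0 then v $ (n - 1) else 0) else 0))"
        using that carr by (intro sum.cong) (auto simp: X E algebra_simps)
      finally show ?thesis using that n by (simp add: sum.distrib sum.delta)
    qed
    have Yu: "v $ i = u $ i + (if i = 0 then 0 else u $ (i - 1))" if i: "i < n" for i
    proof -
      have "v = mat_adjoint Y *\<^sub>v u"
        using v carr assoc_mult_mat_vec[of "mat_adjoint Y" n n "X + E" n v] by (simp add: M_def u_def)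
      then have "v $ i = (\<Sum>j<n. mat_adjoint Y $$ (i,j) * u $ j)"
        using i carr by (simp add: scalar_prod_def lessThan_atLeast0 u_dim)
      also have "\<dots> = (\<Sum>j<n. (if j = i then u $ i else 0) + (if j = i - 1 then (if i = 0 then 0 else u $ (i - 1)) else 0))"
        using i Y by (intro sum.cong) auto
      finally show ?thesis using i by (simp add: sum.distrib sum.delta)
    qed
    \<comment> \<open>Row 0 reads \<open>v $ 0 = v $ 0 + v $ (n - 1)\<close>.\<close>
    have last: "v $ (n - 1) = 0" using Yu[of 0] u[of 0] n by simp
    have "v $ i = 0" if "i < n" for i
    proof (cases "i = n - 1")
      case False
      then have "Suc i < n" using that by simp
      \<comment> \<open>Row \<open>Suc i\<close> has \<open>u $ Suc i = v $ Suc i\<close>, which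
        forces \<open>u $ i = 0\<close>; as the last entry of \<open>v\<close> vanishes,
        \<open>u $ i\<close> is \<open>v $ i\<close>.\<close>
      then show ?thesis using Yu[of "Suc i"] u[of "Suc i"] u[of i] last by (simp split: if_splits)
    qed (use last in simp)
    then have "v = 0\<^sub>v n" using v(1) by (intro eq_vecI) auto
    then show False using v(2) by contradiction
  qed
  then show ?thesis using root1 carr unfolding common_root_def X by auto
qed

theorem theorem3p1:
  fixes n :: nat and \<phi> :: "complex mat \<Rightarrow> complex mat"
  assumes into: "\<And>X. X \<in> toeplitz_alg n \<Longrightarrow> \<phi> X \<in> carrier_mat n n"
    and linear: "\<And>X Y (a::complex) (b::complex). X \<in> toeplitz_alg n \<Longrightarrow> Y \<in> toeplitz_alg n \<Longrightarrow>
          \<phi> (a \<cdot>\<^sub>m X + b \<cdot>\<^sub>m Y) = a \<cdot>\<^sub>m \<phi> X + b \<cdot>\<^sub>m \<phi> Y"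
    and isometry: "\<And>X. X \<in> toeplitz_alg n \<Longrightarrow> opnorm (\<phi> X) = opnorm X"
  shows "\<forall>A \<in> toeplitz_alg n.
           char_poly (mat_adjoint A * A) = char_poly (mat_adjoint (\<phi> A) * \<phi> A)"
proof
  fix A assume A: "A \<in> toeplitz_alg n"
  have carr: "X \<in> carrier_mat n n" if "X \<in> toeplitz_alg n" for X
    using that by (auto simp: toeplitz_alg_iff toeplitz_def)
  show "char_poly (mat_adjoint A * A) = char_poly (mat_adjoint (\<phi> A) * \<phi> A)"
  \<comment> \<open>An empty matrix has characteristic polynomial 1 and no eigenvalue, so the locale
    asks for \<open>n > 0\<close> and the empty case is settled directly.\<close>
  proof (cases "n = 0")
    case True
    then have "mat_adjoint A * A = mat_adjoint (\<phi> A) * \<phi> A"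
      using carr[OF A] into[OF A] by (intro eq_matI) auto
    then show ?thesis by simp
  next
    case False
    interpret matrix_isometry n "toeplitz_alg n" \<phi>
    proof
      fix X Y :: "complex mat" and c :: complex
      assume XY: "X \<in> toeplitz_alg n" "Y \<in> toeplitz_alg n"
      show "X + c \<cdot>\<^sub>m Y \<in> toeplitz_alg n"
        using XY unfolding toeplitz_alg_iff by (metis toeplitz_add_smult)
      have "1 \<cdot>\<^sub>m Z = Z" for Z :: "complex mat" by (intro eq_matI) auto
      then show "\<phi> (X + c \<cdot>\<^sub>m Y) = \<phi> X + c \<cdot>\<^sub>m \<phi> Y"
        using linear[OF XY, of 1 c] by simp
    qed (use False carr into isometry in auto)
    show ?thesis
    proof (rule char_poly_adjoint_mult_eq[OF A _ _ _ _ _ toeplitz_base_point])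
      show "toeplitz n (coeff (monom 1 (n - 1))) $$ (i,j) = 0"
        if "i < n" "j < n" "j \<noteq> n - 1" for i j
        using that by (auto simp: toeplitz_def)
    qed (use False in \<open>auto simp: toeplitz_alg_iff\<close>)
  qed
qed

end
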